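(* Assume that $T$ and the random operators $\{\widehat T_n\}_{n\ge1}$ satisfy: (1) $P(\lim_{n\to\infty}\|\widehat T_n v-Tv\|\ge\epsilon)=0$ for all $\epsilon>0$ and all $v\in\mathbb{R}^{|\mathbb{S}|}$ (i.e. $\widehat T_n(\omega)v\to Tv$ for $P$-almost all $\omega$), and $T$ has a fixed point $v^*$, $Tv^*=v^*$; (2) there is $\kappa^*<\infty$ with $\|v^*\|\le\kappa^*$ such that $\|\hat v_n^k\|\le\kappa^*$ almost surely for all $k\ge0$, $n\ge1$ (for seeds $\hat v_n^0$ with $\|\hat v_n^0\|\le\kappa^*$); (3) $\|Tv-v^*\|\le\alpha\|v-v^*\|$ for all $v\in\mathbb{R}^{|\mathbb{S}|}$; (4) for every $\epsilon>0$ there is a sequence $\{p_n(\epsilon)\}_{n\ge1}$ with $P(\|Tv-\widehat T_nv\|<\epsilon)>p_n(\epsilon)$ for all $v$ with $\|v\|\le\kappa^*$, and $p_n(\epsilon)\uparrow1$ as $n\to\infty$. Then for $v\in\mathbb{R}^{|\mathbb{S}|}$ the following three statements are equivalent: (i) $v$ is a fixed point of $T$; (ii) $v$ is a strong probabilistic fixed point of $\{\widehat T_n\}_{n\ge1}$; (iii) $v$ is a weak probabilistic fixed point of $\{\widehat T_n\}_{n\ge1}$.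
   Context: $\mathbb{S}$ is a finite set, $\|\cdot\|$ the sup norm on $\mathbb{R}^{|\mathbb{S}|}$, $\alpha\in(0,1)$ a constant, $T:\mathbb{R}^{|\mathbb{S}|}\to\mathbb{R}^{|\mathbb{S}|}$ a deterministic operator. $\Omega=[0,1]^\infty$ with its product Borel $\sigma$-algebra $\mathcal F$ and the law $P$ of an i.i.d. sequence of uniform $[0,1]$ variables. For each $n\ge1$, $\widehat T_n$ is a random operator: for each $\omega\in\Omega$, $\widehat T_n(\omega)$ is a map $\mathbb{R}^{|\mathbb{S}|}\to\mathbb{R}^{|\mathbb{S}|}$ (jointly measurable in $(\omega,v)$). On the infinite product $(\Omega^\infty,\mathcal F^\infty,\mathcal P)$ with elements $\boldsymbol\omega=(\omega_j)_{j\ge0}$, whose coordinates are i.i.d. with law $P$, define $\widehat T_n^k(\boldsymbol\omega)v=\widehat T_n(\omega_{k-1})\cdots\widehat T_n(\omega_0)v$ and, for a seed $\hat v_n^0\in\mathbb{R}^{|\mathbb{S}|}$, $\hat v_n^k=\widehat T_n^k\hat v_n^0$. Convention: in these iterations (only), a vector $v$ with $\|v\|>\kappa^*$ is mapped at the next step to its projection $\kappa^*v/\|v\|$ onto the closed ball of radius $\kappa^*$. A vector $\hat v\in\mathbb{R}^{|\mathbb{S}|}$ is a strong probabilistic fixed point of $\{\widehat T_n\}_{n\ge1}$ if $\lim_{n\to\infty}P(\|\widehat T_n\hat v-\hat v\|>\epsilon)=0$ for all $\epsilon>0$. It is a weak probabilistic fixed point of $\{\widehat T_n\}_{n\ge1}$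 if $\lim_{n\to\infty}\limsup_{k\to\infty}\mathcal P(\|\widehat T_n^kv-\hat v\|>\epsilon)=0$ for all $\epsilon>0$ and all $v\in\mathbb{R}^{|\mathbb{S}|}$. *)

theory Defs
  imports "HOL-Probability.Probability"
begin

text \<open>
  Vectors indexed by the finite state space are elements of \<open>real ^ 's\<close> with \<open>'s :: finite\<close>.
  The sup norm is the library's \<open>infnorm\<close>; it must not be confused with \<open>norm\<close>, which is the
  Euclidean norm on this type.
\<close>

lemma infnorm_eq_Max: "infnorm (v :: real ^ 's) = (MAX s. \<bar>v $ s\<bar>)"
proof -
  have B: "(Basis :: (real ^ 's) set) = range (\<lambda>s. axis s 1)"
    by (auto simp: Basis_vec_def)
  show ?thesis
    unfolding infnorm_Max B by (simp add: image_image inner_axis)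
qed

definition unif_seq :: "(nat \<Rightarrow> real) measure" where
  "unif_seq = (\<Pi>\<^sub>M i\<in>UNIV. restrict_space lborel {0..1})"

definition unif_seqs :: "(nat \<Rightarrow> nat \<Rightarrow> real) measure" where
  "unif_seqs = (\<Pi>\<^sub>M j\<in>UNIV. unif_seq)"

lemma prob_space_unif_seq: "prob_space unif_seq"
  unfolding unif_seq_def
  by (intro prob_space_PiM prob_space_restrict_space) simp_all

lemma prob_space_unif_seqs: "prob_space unif_seqs"
  unfolding unif_seqs_def by (intro prob_space_PiM prob_space_unif_seq)

text \<open>A random operator: \<open>\<omega>\<close> is the noise, and the result is jointly measurable in noise and vector.\<close>

definition random_operator :: "((nat \<Rightarrow> real) \<Rightarrow> real ^ 's \<Rightarrow> real ^ 's) \<Rightarrow> bool" where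
  "random_operator F \<longleftrightarrow> (\<lambda>(\<omega>, v). F \<omega> v) \<in> borel_measurable (unif_seq \<Otimes>\<^sub>M borel)"

text \<open>
  One step of the iteration: a vector outside the ball of radius \<open>\<kappa>\<close> is projected onto that ball
  instead of being mapped by the operator.  Only iterations use this; the operators themselves
  are not modified.
\<close>

definition proj_step :: "real \<Rightarrow> (real ^ 's \<Rightarrow> real ^ 's) \<Rightarrow> real ^ 's \<Rightarrow> real ^ 's" where
  "proj_step \<kappa> f v = (if infnorm v > \<kappa> then (\<kappa> / infnorm v) *\<^sub>R v else f v)"

primrec iterate :: "real \<Rightarrow> ((nat \<Rightarrow> real) \<Rightarrow> real ^ 's \<Rightarrow> real ^ 's) \<Rightarrow> nat
    \<Rightarrow> (nat \<Rightarrow> nat \<Rightarrow> real) \<Rightarrow> real ^ 's \<Rightarrow> real ^ 's" where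
  "iterate \<kappa> F 0 w v = v"
| "iterate \<kappa> F (Suc k) w v = proj_step \<kappa> (F (w k)) (iterate \<kappa> F k w v)"

definition strong_prob_fixed_point ::
    "(nat \<Rightarrow> (nat \<Rightarrow> real) \<Rightarrow> real ^ 's \<Rightarrow> real ^ 's) \<Rightarrow> real ^ 's \<Rightarrow> bool" where
  "strong_prob_fixed_point That v \<longleftrightarrow>
    (\<forall>\<epsilon>>0. (\<lambda>n. \<P>(\<omega> in unif_seq. infnorm (That n \<omega> v - v) > \<epsilon>)) \<longlonglongrightarrow> 0)"

text \<open>
  The inner limit superior is taken in \<open>ereal\<close>, since \<open>limsup\<close> requires a complete lattice.
\<close>

definition weak_prob_fixed_point ::
    "real \<Rightarrow> (nat \<Rightarrow> (nat \<Rightarrow> real) \<Rightarrow> real ^ 's \<Rightarrow> real ^ 's) \<Rightarrow> real ^ 's \<Rightarrow> bool" where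
  "weak_prob_fixed_point \<kappa> That v \<longleftrightarrow>
    (\<forall>\<epsilon>>0. \<forall>u. (\<lambda>n. limsup (\<lambda>k.
        ereal \<P>(w in unif_seqs. infnorm (iterate \<kappa> (That n) k w u - v) > \<epsilon>))) \<longlonglongrightarrow> 0)"

end

theory Submission
  imports Defs
begin

text \<open>
  All three conditions say \<open>v = vstar\<close>.

  For a fixed point of \<open>T\<close> this is the contraction towards \<open>vstar\<close>:
  \<open>T v = v\<close> gives \<open>infnorm (v - vstar) \<le> \<alpha> * infnorm (v - vstar)\<close> with \<open>\<alpha> < 1\<close>.

  For a strong probabilistic fixed point, almost sure convergence of \<open>That n \<omega> v\<close> to \<open>T v\<close> implies
  convergence in probability, and limits in probability are unique; so being concentrated near \<open>v\<close>
  means exactly \<open>T v = v\<close> (lemma \<open>AE_limit_eq_iff_strong_prob_fixed_point\<close>).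

  For a weak probabilistic fixed point, uniqueness is again uniqueness of the point near which
  a random vector concentrates (\<open>weak_prob_fixed_point_unique\<close>), and what remains is that
  \<open>vstar\<close> is one (\<open>contraction_centre_weak_prob_fixed_point\<close>). Fix \<open>\<delta> > 0\<close> and let \<open>q\<close> bound the
  probability that \<open>That n\<close> differs from \<open>T\<close> by \<open>\<delta>\<close> or more at a given point of the ball of
  radius \<open>\<kappa>\<close>. From the first step on, the iteration almost surely stays in that ball, so
  its distance to \<open>vstar\<close> is at most \<open>2 * \<kappa>\<close>. A step at which the two operators are
  \<open>\<delta>\<close>-close turns a distance \<open>r\<close> into at most \<open>\<alpha> * r + \<delta>\<close>; hence after \<open>m\<close> consecutive such steps
  the distance is at most \<open>\<alpha> ^ m * (2 * \<kappa>) + \<delta> / (1 - \<alpha>)\<close>, and by the union bound this fails with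
  probability at most \<open>m * q\<close>. The bound does not depend on how many steps (at least one) came
  before these \<open>m\<close>, so it bounds the limit superior over the number of steps. Choosing \<open>\<delta>\<close> and then \<open>m\<close> makes
  the radius at most \<open>\<epsilon>\<close>; with \<open>m\<close> fixed, \<open>m * q\<close> tends to 0 as \<open>n\<close> grows.

  The one probabilistic ingredient is that the noise used at a step is independent of the
  current iterate (\<open>iterate_escape_prob_Suc\<close>).
\<close>

section \<open>Concentration of random vectors in the sup norm\<close>

lemma borel_measurable_infnorm [measurable (raw)]:
  assumes "f \<in> borel_measurable M"
  shows "(\<lambda>x. infnorm (f x :: 'a::euclidean_space)) \<in> borel_measurable M"
  using assms by (rule borel_measurable_continuous_on[rotated]) (intro continuous_intros)

lemma infnorm_diff_triangle: "infnorm (x - z) \<le> infnorm (x - y) + infnorm (y - z)"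
  using infnorm_triangle[of "x - y" "y - z"] by simp

text \<open>
  Uniqueness of limits in probability, in quantitative form: if the two deviation events do not
  fill the space, some outcome is within \<open>\<epsilon>\<close> of both points.
\<close>

lemma (in prob_space) concentration_centres_close:
  fixes X :: "'a \<Rightarrow> 'b::euclidean_space"
  assumes [measurable]: "X \<in> borel_measurable M"
    and less_1: "\<P>(x in M. infnorm (X x - a) > \<epsilon>) + \<P>(x in M. infnorm (X x - b) > \<epsilon>) < 1"
  shows "infnorm (a - b) \<le> 2 * \<epsilon>"
proof -
  let ?A = "{x \<in> space M. infnorm (X x - a) > \<epsilon>}" and ?B = "{x \<in> space M. infnorm (X x - b) > \<epsilon>}"
  have "prob (?A \<union> ?B) \<le> prob ?A + prob ?B"
    by (intro measure_Un_le) measurable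
  with less_1 have "?A \<union> ?B \<noteq> space M"
    using prob_space by fastforce
  then obtain x where "infnorm (X x - a) \<le> \<epsilon>" "infnorm (X x - b) \<le> \<epsilon>"
    using not_less by blast
  then show ?thesis
    using infnorm_diff_triangle[of a b "X x"] infnorm_sub[of a "X x"] by linarith
qed

text \<open>
  Almost sure convergence implies convergence in probability: the indicators of the tail events
  tend to 0 almost surely and are dominated by 1.
\<close>

lemma (in prob_space) AE_tendsto_0_imp_tail_prob_tendsto_0:
  assumes [measurable]: "\<And>n. Y n \<in> borel_measurable M"
    and lim: "AE x in M. (\<lambda>n. Y n x) \<longlonglongrightarrow> (0::real)"
    and "\<epsilon> > 0"
  shows "(\<lambda>n. \<P>(x in M. Y n x > \<epsilon>)) \<longlonglongrightarrow> 0"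
proof -
  have "(\<lambda>n. \<integral>x. indicator {x \<in> space M. Y n x > \<epsilon>} x \<partial>M) \<longlonglongrightarrow> (\<integral>x. (0::real) \<partial>M)"
  proof (rule integral_dominated_convergence[where w = "\<lambda>_. 1"])
    show "AE x in M. (\<lambda>n. indicator {x \<in> space M. Y n x > \<epsilon>} x) \<longlonglongrightarrow> (0::real)"
      using lim
    proof eventually_elim
      case (elim x)
      then have "\<forall>\<^sub>F n in sequentially. Y n x < \<epsilon>"
        using \<open>\<epsilon> > 0\<close> by (rule order_tendstoD)
      then show ?case
        by (intro tendsto_eventually) (auto elim!: eventually_mono)
    qed
  qed (auto simp: indicator_def)
  moreover have "(\<integral>x. indicator {x \<in> space M. Y n x > \<epsilon>} x \<partial>M) = \<P>(x in M. Y n x > \<epsilon>)" for n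
    by (simp add: Int_absorb1 Collect_conj_eq)
  ultimately show ?thesis
    by simp
qed

section \<open>One step of the random iteration\<close>

lemma random_operator_measurable:
  assumes "random_operator F" "f \<in> measurable N unif_seq" "g \<in> borel_measurable N"
  shows "(\<lambda>x. F (f x) (g x)) \<in> borel_measurable N"
  using measurable_compose[OF measurable_Pair[OF assms(2,3)], of "\<lambda>(\<omega>, v). F \<omega> v" borel] assms(1)
  by (simp add: random_operator_def)

lemma proj_step_measurable:
  assumes "random_operator F" "f \<in> measurable N unif_seq" "g \<in> borel_measurable N"
  shows "(\<lambda>x. proj_step \<kappa> (F (f x)) (g x)) \<in> borel_measurable N"
proof -
  note [measurable] = assms(3) random_operator_measurable[OF assms]
  show ?thesis
    unfolding proj_step_def by measurable
qed

lemma unif_seqs_coord_measurable [measurable]: "(\<lambda>w. w k) \<in> measurable unif_seqs unif_seq"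
  unfolding unif_seqs_def by measurable

lemma iterate_measurable:
  assumes "random_operator F"
  shows "(\<lambda>w. iterate \<kappa> F k w u) \<in> borel_measurable unif_seqs"
  by (induction k) (auto intro!: proj_step_measurable assms)

lemma iterate_cong:
  assumes "\<And>j. j < k \<Longrightarrow> w j = w' j"
  shows "iterate \<kappa> F k w u = iterate \<kappa> F k w' u"
  using assms by (induction k) auto

text \<open>
  Replacing the noise from time \<open>k\<close> on by an independent copy does not change the law. This is
  the form of independence used below: the iterate at time \<open>k\<close> reads only the first copy, the
  next step only the second.
\<close>

lemma unif_seqs_splice:
  "distr (unif_seqs \<Otimes>\<^sub>M unif_seqs) unif_seqs (\<lambda>(w, w'). comb_seq k w w') = unif_seqs"
proof -
  interpret sequence_space unif_seq
    by (simp add: sequence_space_def product_prob_space_def product_prob_space_axioms_def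
        product_sigma_finite_def prob_space_unif_seq prob_space_imp_sigma_finite)
  show ?thesis
    unfolding unif_seqs_def by (rule PiM_comb_seq)
qed

lemma unif_seqs_coord_distr: "distr unif_seqs unif_seq (\<lambda>w. w k) = unif_seq"
  unfolding unif_seqs_def by (intro distr_PiM_component prob_space_unif_seq) auto

text \<open>
  A union bound over one step. The noise \<open>w k\<close> is independent of the iterate at time \<open>k\<close>, so a bound
  \<open>q\<close> on the escape probability from each deterministic point of \<open>A\<close> carries over to the random
  iterate by Fubini. Escape from sets is used here, and not a deviation from the limiting operator
  \<open>T\<close> below, because nothing is known in advance about the measurability of \<open>T\<close>: deviating from it
  at a random point need not be an event, while deviating at a fixed point is.
\<close>

lemma iterate_escape_prob_Suc:
  assumes F: "random_operator F"
    and [measurable]: "A \<in> sets borel" "B \<in> sets borel"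
    and "q \<ge> 0"
    and step: "\<And>x. x \<in> A \<Longrightarrow> \<P>(\<omega> in unif_seq. proj_step \<kappa> (F \<omega>) x \<notin> B) \<le> q"
  shows "\<P>(w in unif_seqs. iterate \<kappa> F (Suc k) w u \<notin> B)
    \<le> \<P>(w in unif_seqs. iterate \<kappa> F k w u \<notin> A) + q"
proof -
  interpret S: prob_space unif_seqs by (rule prob_space_unif_seqs)
  interpret U: prob_space unif_seq by (rule prob_space_unif_seq)
  let ?X = "\<lambda>k w. iterate \<kappa> F k w u"
  let ?G = "\<lambda>(w, w'). proj_step \<kappa> (F (w' 0)) (?X k w)"
  note [measurable] = iterate_measurable[OF F]
  have step_meas [measurable]: "(\<lambda>\<omega>. proj_step \<kappa> (F \<omega>) x) \<in> borel_measurable unif_seq" for x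
    by (intro proj_step_measurable[OF F]) measurable
  have splice_meas: "(\<lambda>(w, w'). comb_seq k w w') \<in> measurable (unif_seqs \<Otimes>\<^sub>M unif_seqs) unif_seqs"
    unfolding unif_seqs_def by (rule measurable_comb_seq)
  have G [measurable]: "?G \<in> borel_measurable (unif_seqs \<Otimes>\<^sub>M unif_seqs)"
    unfolding split_beta' by (intro proj_step_measurable[OF F]) measurable
  have spliced: "?X (Suc k) (comb_seq k w w') = ?G (w, w')" for w w'
    using iterate_cong[of k "comb_seq k w w'" w \<kappa> F u] comb_seq_add[of k w w' 0]
    by (simp add: comb_seq_less)
  have fresh: "emeasure unif_seqs {w' \<in> space unif_seqs. ?G (w, w') \<notin> B}
      = emeasure unif_seq {\<omega> \<in> space unif_seq. proj_step \<kappa> (F \<omega>) (?X k w) \<notin> B}" for w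
  proof -
    have "emeasure (distr unif_seqs unif_seq (\<lambda>w'. w' 0))
          {\<omega> \<in> space unif_seq. proj_step \<kappa> (F \<omega>) (?X k w) \<notin> B}
        = emeasure unif_seqs {w' \<in> space unif_seqs. ?G (w, w') \<notin> B}"
      by (subst emeasure_distr, measurable)
        (auto intro!: arg_cong[where f = "emeasure unif_seqs"]
          dest: measurable_space[OF unif_seqs_coord_measurable])
    then show ?thesis
      by (simp only: unif_seqs_coord_distr)
  qed
  have "emeasure unif_seqs {w \<in> space unif_seqs. ?X (Suc k) w \<notin> B}
      = emeasure (unif_seqs \<Otimes>\<^sub>M unif_seqs) {p \<in> space (unif_seqs \<Otimes>\<^sub>M unif_seqs). ?G p \<notin> B}"
    by (subst unif_seqs_splice[of k, symmetric], subst emeasure_distr[OF splice_meas], measurable,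
        rule arg_cong[where f = "emeasure (unif_seqs \<Otimes>\<^sub>M unif_seqs)"])
      (use measurable_space[OF splice_meas] in \<open>auto simp: spliced simp del: iterate.simps(2)\<close>)
  also have "\<dots> = (\<integral>\<^sup>+w. emeasure unif_seqs {w' \<in> space unif_seqs. ?G (w, w') \<notin> B} \<partial>unif_seqs)"
    by (subst S.emeasure_pair_measure_alt, measurable,
        intro nn_integral_cong arg_cong[where f = "emeasure unif_seqs"])
      (auto simp: space_pair_measure)
  also have "\<dots> \<le> (\<integral>\<^sup>+w. indicator {w \<in> space unif_seqs. ?X k w \<notin> A} w + ennreal q \<partial>unif_seqs)"
  proof (rule nn_integral_mono, unfold fresh)
    fix w assume w: "w \<in> space unif_seqs"
    show "emeasure unif_seq {\<omega> \<in> space unif_seq. proj_step \<kappa> (F \<omega>) (?X k w) \<notin> B}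
        \<le> indicator {w \<in> space unif_seqs. ?X k w \<notin> A} w + ennreal q"
    proof (cases "?X k w \<in> A")
      case True
      then show ?thesis
        using step[OF True] \<open>q \<ge> 0\<close> by (simp add: U.emeasure_eq_measure ennreal_leI)
    next
      case False
      have "emeasure unif_seq {\<omega> \<in> space unif_seq. proj_step \<kappa> (F \<omega>) (?X k w) \<notin> B} \<le> 1"
        by (rule U.measure_le_1)
      also have "\<dots> \<le> indicator {w \<in> space unif_seqs. ?X k w \<notin> A} w + ennreal q"
        using False w by simp
      finally show ?thesis .
    qed
  qed
  also have "\<dots> = emeasure unif_seqs {w \<in> space unif_seqs. ?X k w \<notin> A} + ennreal q"
    by (subst nn_integral_add) (auto simp: S.emeasure_space_1)
  finally show ?thesis
    using \<open>q \<ge> 0\<close>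
    by (simp add: S.emeasure_eq_measure del: iterate.simps(2) flip: ennreal_plus)
qed

lemma proj_step_in_ball:
  assumes "infnorm v > \<kappa>" "\<kappa> \<ge> 0"
  shows "infnorm (proj_step \<kappa> f v) \<le> \<kappa>"
  using assms by (simp add: proj_step_def infnorm_mul infnorm_pos_le)

text \<open>
  The first step ends in the ball for an arbitrary seed: a seed inside is mapped into
  the ball almost surely, and a seed outside is projected onto it. Later steps cannot leave it.
\<close>

lemma iterate_leaves_ball_prob_0:
  fixes F :: "(nat \<Rightarrow> real) \<Rightarrow> real ^ 's \<Rightarrow> real ^ 's"
  assumes F: "random_operator F"
    and ball: "\<And>v. infnorm v \<le> \<kappa> \<Longrightarrow> AE \<omega> in unif_seq. infnorm (F \<omega> v) \<le> \<kappa>"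
    and "\<kappa> \<ge> 0"
  shows "\<P>(w in unif_seqs. infnorm (iterate \<kappa> F (Suc k) w u) > \<kappa>) = 0"
proof -
  interpret U: prob_space unif_seq by (rule prob_space_unif_seq)
  let ?B = "{v :: real ^ 's. infnorm v \<le> \<kappa>}"
  have B: "?B \<in> sets borel"
    by measurable
  have stay: "\<P>(\<omega> in unif_seq. proj_step \<kappa> (F \<omega>) x \<notin> ?B) \<le> 0" for x
  proof (cases "infnorm x \<le> \<kappa>")
    case True
    have [measurable]: "(\<lambda>\<omega>. F \<omega> x) \<in> borel_measurable unif_seq"
      by (intro random_operator_measurable[OF F]) measurable
    have "\<P>(\<omega> in unif_seq. infnorm (F \<omega> x) > \<kappa>) = 0"
      using ball[OF True] by (subst U.prob_eq_0) (auto simp: not_less)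
    with True show ?thesis
      by (simp add: proj_step_def not_le)
  next
    case False
    then show ?thesis
      using proj_step_in_ball[of \<kappa> x] \<open>\<kappa> \<ge> 0\<close> by simp
  qed
  have "\<P>(w in unif_seqs. iterate \<kappa> F (Suc k) w u \<notin> ?B) \<le> 0"
  proof (induction k)
    case 0
    \<comment> \<open>\<open>A = UNIV\<close>: the first step needs no information about the seed.\<close>
    show ?case
      using iterate_escape_prob_Suc[OF F, of UNIV ?B 0 \<kappa> 0 u] B stay by simp
  next
    case (Suc k)
    show ?case
      using iterate_escape_prob_Suc[OF F B B order_refl stay, of "Suc k" u] Suc by linarith
  qed
  then show ?thesis
    by (simp add: not_le measure_le_0_iff del: iterate.simps(2))
qed

section \<open>The weak probabilistic fixed point\<close>

text \<open>
  The sets \<open>C m\<close> in the proof are the target sets after \<open>m\<close> further steps. Their radii \<open>r m\<close> solve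
  the recursion \<open>r (Suc m) = \<alpha> * r m + \<delta>\<close> that bounds the distance to \<open>vstar\<close> as long as the
  random operator is \<open>\<delta>\<close>-close to \<open>T\<close>. Starting from \<open>r 0 \<ge> 2 * \<kappa>\<close> makes \<open>C 0\<close> the whole ball, so the
  bound is uniform in \<open>k\<close> and \<open>u\<close>.
\<close>

lemma iterate_far_prob_bound:
  fixes F :: "(nat \<Rightarrow> real) \<Rightarrow> real ^ 's \<Rightarrow> real ^ 's"
  assumes F: "random_operator F"
    and ball: "\<And>v. infnorm v \<le> \<kappa> \<Longrightarrow> AE \<omega> in unif_seq. infnorm (F \<omega> v) \<le> \<kappa>"
    and close: "\<And>v. infnorm v \<le> \<kappa> \<Longrightarrow> \<P>(\<omega> in unif_seq. infnorm (T v - F \<omega> v) < \<delta>) \<ge> 1 - q"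
    and T: "\<And>v. infnorm (T v - vstar) \<le> \<alpha> * infnorm (v - vstar)"
    and "infnorm vstar \<le> \<kappa>" "0 < \<alpha>" "\<alpha> < 1" "\<delta> \<ge> 0"
  shows "\<P>(w in unif_seqs. infnorm (iterate \<kappa> F (Suc k + m) w u - vstar)
            > \<alpha> ^ m * (2 * \<kappa>) + \<delta> / (1 - \<alpha>)) \<le> m * q"
proof -
  interpret S: prob_space unif_seqs by (rule prob_space_unif_seqs)
  interpret U: prob_space unif_seq by (rule prob_space_unif_seq)
  note [measurable] = iterate_measurable[OF F]
  have F_meas [measurable]: "(\<lambda>\<omega>. F \<omega> x) \<in> borel_measurable unif_seq" for x
    by (intro random_operator_measurable[OF F]) measurable
  have "\<kappa> \<ge> 0"
    using \<open>infnorm vstar \<le> \<kappa>\<close> infnorm_pos_le[of vstar] by linarith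
  have "q \<ge> 0"
    using order_trans[OF close[OF \<open>infnorm vstar \<le> \<kappa>\<close>] U.prob_le_1] by simp
  define r where "r m = \<alpha> ^ m * (2 * \<kappa>) + \<delta> / (1 - \<alpha>)" for m :: nat
  have r_Suc: "r (Suc m) = \<alpha> * r m + \<delta>" for m
    using \<open>\<alpha> < 1\<close> by (simp add: r_def field_simps)
  define C :: "nat \<Rightarrow> (real ^ 's) set"
    where "C m = {v. infnorm v \<le> \<kappa> \<and> infnorm (v - vstar) \<le> r m}" for m
  have C [measurable]: "C m \<in> sets borel" for m
    unfolding C_def by measurable
  have step: "\<P>(\<omega> in unif_seq. proj_step \<kappa> (F \<omega>) x \<notin> C (Suc m)) \<le> q" if "x \<in> C m" for x m
  proof -
    have x: "infnorm x \<le> \<kappa>" "infnorm (x - vstar) \<le> r m"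
      using that by (auto simp: C_def)
    have "\<P>(\<omega> in unif_seq. proj_step \<kappa> (F \<omega>) x \<notin> C (Suc m))
        \<le> \<P>(\<omega> in unif_seq. \<not> infnorm (T x - F \<omega> x) < \<delta>)"
    proof (rule U.finite_measure_mono_AE)
      show "AE \<omega> in unif_seq. \<omega> \<in> {\<omega> \<in> space unif_seq. proj_step \<kappa> (F \<omega>) x \<notin> C (Suc m)}
          \<longrightarrow> \<omega> \<in> {\<omega> \<in> space unif_seq. \<not> infnorm (T x - F \<omega> x) < \<delta>}"
        using ball[OF x(1)]
      proof eventually_elim
        case (elim \<omega>)
        have "infnorm (F \<omega> x - vstar) \<le> r (Suc m)" if "infnorm (T x - F \<omega> x) < \<delta>"
        proof -
          have "\<alpha> * infnorm (x - vstar) \<le> \<alpha> * r m"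
            using x(2) \<open>0 < \<alpha>\<close> by simp
          then show ?thesis
            using that T[of x] infnorm_diff_triangle[of "F \<omega> x" vstar "T x"]
              infnorm_sub[of "F \<omega> x" "T x"] by (simp add: r_Suc)
        qed
        with elim x(1) show ?case
          by (auto simp: C_def proj_step_def)
      qed
    qed measurable
    also have "\<dots> = 1 - \<P>(\<omega> in unif_seq. infnorm (T x - F \<omega> x) < \<delta>)"
      by (rule U.prob_neg) measurable
    also have "\<dots> \<le> q"
      using close[OF x(1)] by simp
    finally show ?thesis .
  qed
  have "\<P>(w in unif_seqs. iterate \<kappa> F (Suc k + m) w u \<notin> C m) \<le> m * q"
  proof (induction m)
    case 0
    have "infnorm (v - vstar) \<le> r 0" if "infnorm v \<le> \<kappa>" for v
    proof -
      have "infnorm (v - vstar) \<le> infnorm v + infnorm vstar"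
        using infnorm_triangle[of v "- vstar"] by (simp add: infnorm_neg)
      moreover have "\<delta> / (1 - \<alpha>) \<ge> 0"
        using \<open>\<delta> \<ge> 0\<close> \<open>\<alpha> < 1\<close> by simp
      ultimately show ?thesis
        using that \<open>infnorm vstar \<le> \<kappa>\<close> by (simp add: r_def)
    qed
    then have "C 0 = {v. infnorm v \<le> \<kappa>}"
      by (auto simp: C_def)
    then show ?case
      using iterate_leaves_ball_prob_0[OF F ball \<open>\<kappa> \<ge> 0\<close>, of k u]
      by (simp add: not_le del: iterate.simps(2))
  next
    case (Suc m)
    have "\<P>(w in unif_seqs. iterate \<kappa> F (Suc (Suc k + m)) w u \<notin> C (Suc m))
        \<le> \<P>(w in unif_seqs. iterate \<kappa> F (Suc k + m) w u \<notin> C m) + q"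
      by (rule iterate_escape_prob_Suc[OF F C C \<open>q \<ge> 0\<close> step])
    with Suc show ?case
      by (simp add: algebra_simps del: iterate.simps(2))
  qed
  moreover have "\<P>(w in unif_seqs. infnorm (iterate \<kappa> F (Suc k + m) w u - vstar) > r m)
      \<le> \<P>(w in unif_seqs. iterate \<kappa> F (Suc k + m) w u \<notin> C m)"
    by (rule S.finite_measure_mono) (auto simp: C_def simp del: iterate.simps(2))
  ultimately show ?thesis
    unfolding r_def by linarith
qed

text \<open>
  The order of choices matters: \<open>\<delta>\<close> makes the accumulated error \<open>\<delta> / (1 - \<alpha>)\<close> equal to \<open>\<epsilon> / 2\<close>, then
  \<open>m\<close> brings the contracted initial distance below \<open>\<epsilon> / 2\<close>, and only then does \<open>n\<close> tend to infinity.
\<close>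

lemma contraction_centre_weak_prob_fixed_point:
  fixes That :: "nat \<Rightarrow> (nat \<Rightarrow> real) \<Rightarrow> real ^ 's \<Rightarrow> real ^ 's"
  assumes That: "\<And>n. n \<ge> 1 \<Longrightarrow> random_operator (That n)"
    and ball: "\<And>n v. n \<ge> 1 \<Longrightarrow> infnorm v \<le> \<kappa> \<Longrightarrow> AE \<omega> in unif_seq. infnorm (That n \<omega> v) \<le> \<kappa>"
    and T: "\<And>v. infnorm (T v - vstar) \<le> \<alpha> * infnorm (v - vstar)"
    and close: "\<And>\<epsilon>. \<epsilon> > 0 \<Longrightarrow> \<exists>p :: nat \<Rightarrow> real. p \<longlonglongrightarrow> 1 \<and> (\<forall>n\<ge>1. \<forall>v. infnorm v \<le> \<kappa> \<longrightarrow>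
           \<P>(\<omega> in unif_seq. infnorm (T v - That n \<omega> v) < \<epsilon>) \<ge> p n)"
    and vstar: "infnorm vstar \<le> \<kappa>" and \<alpha>: "0 < \<alpha>" "\<alpha> < 1"
  shows "weak_prob_fixed_point \<kappa> That vstar"
  unfolding weak_prob_fixed_point_def
proof (intro allI impI)
  fix \<epsilon> :: real and u :: "real ^ 's"
  assume "\<epsilon> > 0"
  interpret S: prob_space unif_seqs by (rule prob_space_unif_seqs)
  define \<delta> where "\<delta> = \<epsilon> / 2 * (1 - \<alpha>)"
  have "\<delta> > 0"
    using \<open>\<epsilon> > 0\<close> \<alpha> by (simp add: \<delta>_def)
  have "(\<lambda>m. \<alpha> ^ m * (2 * \<kappa>)) \<longlonglongrightarrow> 0"
    using \<alpha> by (intro tendsto_mult_left_zero LIMSEQ_power_zero) simp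
  then have "\<forall>\<^sub>F m in sequentially. \<alpha> ^ m * (2 * \<kappa>) < \<epsilon> / 2"
    using \<open>\<epsilon> > 0\<close> by (intro order_tendstoD(2)) auto
  then obtain m where "\<alpha> ^ m * (2 * \<kappa>) < \<epsilon> / 2"
    using eventually_happens'[OF sequentially_bot] by blast
  moreover have "\<delta> / (1 - \<alpha>) = \<epsilon> / 2"
    unfolding \<delta>_def by (rule nonzero_mult_div_cancel_right) (use \<alpha> in simp)
  ultimately have radius: "\<alpha> ^ m * (2 * \<kappa>) + \<delta> / (1 - \<alpha>) \<le> \<epsilon>"
    by linarith
  obtain p :: "nat \<Rightarrow> real" where "p \<longlonglongrightarrow> 1"
    and p: "\<And>n v. n \<ge> 1 \<Longrightarrow> infnorm v \<le> \<kappa> \<Longrightarrow>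
      \<P>(\<omega> in unif_seq. infnorm (T v - That n \<omega> v) < \<delta>) \<ge> p n"
    using close[OF \<open>\<delta> > 0\<close>] by blast
  let ?P = "\<lambda>n k. \<P>(w in unif_seqs. infnorm (iterate \<kappa> (That n) k w u - vstar) > \<epsilon>)"
  have bound: "?P n (Suc k + m) \<le> m * (1 - p n)" if "n \<ge> 1" for n k
  proof -
    note [measurable] = iterate_measurable[OF That[OF that]]
    have "?P n (Suc k + m) \<le> \<P>(w in unif_seqs.
        infnorm (iterate \<kappa> (That n) (Suc k + m) w u - vstar) > \<alpha> ^ m * (2 * \<kappa>) + \<delta> / (1 - \<alpha>))"
      using radius by (intro S.finite_measure_mono) (auto simp del: iterate.simps(2))
    also have "\<dots> \<le> m * (1 - p n)"
      using that p \<open>\<delta> > 0\<close>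
      by (intro iterate_far_prob_bound[where T = T] That ball T vstar \<alpha>) auto
    finally show ?thesis .
  qed
  have upper: "limsup (\<lambda>k. ereal (?P n k)) \<le> ereal (m * (1 - p n))" if "n \<ge> 1" for n
  proof (rule Limsup_bounded)
    have "?P n k \<le> m * (1 - p n)" if "k \<ge> Suc m" for k
      using bound[OF \<open>n \<ge> 1\<close>, of "k - Suc m"] that by (simp del: iterate.simps(2))
    then show "\<forall>\<^sub>F k in sequentially. ereal (?P n k) \<le> ereal (m * (1 - p n))"
      unfolding eventually_sequentially by auto
  qed
  have lower: "0 \<le> limsup (\<lambda>k. ereal (?P n k))" for n
    by (intro le_Limsup always_eventually) auto
  have "(\<lambda>n. m * (1 - p n)) \<longlonglongrightarrow> real m * (1 - 1)"
    by (intro tendsto_intros \<open>p \<longlonglongrightarrow> 1\<close>)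
  then have "(\<lambda>n. ereal (m * (1 - p n))) \<longlonglongrightarrow> 0"
    by (simp add: zero_ereal_def)
  then show "(\<lambda>n. limsup (\<lambda>k. ereal (?P n k))) \<longlonglongrightarrow> 0"
    by (rule tendsto_sandwich[OF _ _ tendsto_const, rotated 2])
      (auto simp: lower upper eventually_sequentially intro!: exI[of _ 1])
qed

text \<open>
  For large \<open>n\<close> both limits superior are below \<open>1/2\<close>, so some iterate lies within \<open>\<epsilon>\<close> of \<open>a\<close> and of \<open>b\<close>
  with positive probability; this is impossible when \<open>\<epsilon>\<close> is a third of the distance of \<open>a\<close> and \<open>b\<close>.
\<close>

lemma weak_prob_fixed_point_unique:
  fixes That :: "nat \<Rightarrow> (nat \<Rightarrow> real) \<Rightarrow> real ^ 's \<Rightarrow> real ^ 's"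
  assumes That: "\<And>n. n \<ge> 1 \<Longrightarrow> random_operator (That n)"
    and a: "weak_prob_fixed_point \<kappa> That a" and b: "weak_prob_fixed_point \<kappa> That b"
  shows "a = b"
proof (rule ccontr)
  assume "a \<noteq> b"
  define \<epsilon> where "\<epsilon> = infnorm (a - b) / 3"
  have "\<epsilon> > 0"
    using \<open>a \<noteq> b\<close> by (simp add: \<epsilon>_def infnorm_pos_lt)
  let ?P = "\<lambda>c n k. \<P>(w in unif_seqs. infnorm (iterate \<kappa> (That n) k w 0 - c) > \<epsilon>)"
  have ev: "\<forall>\<^sub>F n in sequentially. limsup (\<lambda>k. ereal (?P c n k)) < ereal (1/2)"
    if "weak_prob_fixed_point \<kappa> That c" for c
    using that \<open>\<epsilon> > 0\<close> unfolding weak_prob_fixed_point_def by (intro order_tendstoD(2)) auto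
  obtain n where "n \<ge> 1"
    and lim: "limsup (\<lambda>k. ereal (?P a n k)) < ereal (1/2)" "limsup (\<lambda>k. ereal (?P b n k)) < ereal (1/2)"
    using eventually_happens'[OF _ eventually_conj[OF eventually_ge_at_top[of 1]
      eventually_conj[OF ev[OF a] ev[OF b]]]] by auto
  obtain k where "?P a n k < 1/2" "?P b n k < 1/2"
    using eventually_happens'[OF _ eventually_conj[OF Limsup_lessD[OF lim(1)] Limsup_lessD[OF lim(2)]]]
    by auto
  then have "infnorm (a - b) \<le> 2 * \<epsilon>"
    by (intro prob_space.concentration_centres_close[OF prob_space_unif_seqs
        iterate_measurable[OF That[OF \<open>n \<ge> 1\<close>]], of _ \<kappa> k 0]) linarith
  with \<open>\<epsilon> > 0\<close> show False
    by (simp add: \<epsilon>_def)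
qed

section \<open>The strong probabilistic fixed point\<close>

text \<open>
  The deviations from the almost sure limit \<open>y\<close> vanish in probability. A strong probabilistic
  fixed point is a limit in probability as well, and the two limits agree.
\<close>

lemma AE_limit_eq_iff_strong_prob_fixed_point:
  fixes That :: "nat \<Rightarrow> (nat \<Rightarrow> real) \<Rightarrow> real ^ 's \<Rightarrow> real ^ 's"
  assumes That: "\<And>n. n \<ge> 1 \<Longrightarrow> random_operator (That n)"
    and lim: "AE \<omega> in unif_seq. (\<lambda>n. infnorm (That n \<omega> v - y)) \<longlonglongrightarrow> 0"
  shows "y = v \<longleftrightarrow> strong_prob_fixed_point That v"
proof -
  interpret U: prob_space unif_seq by (rule prob_space_unif_seq)
  \<comment> \<open>Measurability is available from index 1 on, hence the shift by \<open>Suc\<close>.\<close>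
  have That_meas [measurable]: "(\<lambda>\<omega>. That (Suc n) \<omega> v) \<in> borel_measurable unif_seq" for n
    by (intro random_operator_measurable[OF That]) simp_all
  let ?P = "\<lambda>\<epsilon> c n. \<P>(\<omega> in unif_seq. infnorm (That n \<omega> v - c) > \<epsilon>)"
  have y: "?P \<epsilon> y \<longlonglongrightarrow> 0" if "\<epsilon> > 0" for \<epsilon>
  proof -
    have "AE \<omega> in unif_seq. (\<lambda>n. infnorm (That (Suc n) \<omega> v - y)) \<longlonglongrightarrow> 0"
      using lim by eventually_elim (rule LIMSEQ_Suc)
    then have "(\<lambda>n. ?P \<epsilon> y (Suc n)) \<longlonglongrightarrow> 0"
      by (intro U.AE_tendsto_0_imp_tail_prob_tendsto_0 that) measurable
    then show ?thesis
      by (rule LIMSEQ_imp_Suc)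
  qed
  show ?thesis
  proof
    assume "y = v"
    with y show "strong_prob_fixed_point That v"
      by (simp add: strong_prob_fixed_point_def)
  next
    assume strong: "strong_prob_fixed_point That v"
    show "y = v"
    proof (rule ccontr)
      assume "y \<noteq> v"
      define \<epsilon> where "\<epsilon> = infnorm (y - v) / 3"
      have "\<epsilon> > 0"
        using \<open>y \<noteq> v\<close> by (simp add: \<epsilon>_def infnorm_pos_lt)
      have "?P \<epsilon> v \<longlonglongrightarrow> 0"
        using strong \<open>\<epsilon> > 0\<close> by (simp add: strong_prob_fixed_point_def)
      then have "(\<lambda>n. ?P \<epsilon> y (Suc n) + ?P \<epsilon> v (Suc n)) \<longlonglongrightarrow> 0 + 0"
        by (intro tendsto_add LIMSEQ_Suc y \<open>\<epsilon> > 0\<close>)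
      then have "\<forall>\<^sub>F n in sequentially. ?P \<epsilon> y (Suc n) + ?P \<epsilon> v (Suc n) < 1"
        by (intro order_tendstoD(2)) auto
      then obtain n where "?P \<epsilon> y (Suc n) + ?P \<epsilon> v (Suc n) < 1"
        using eventually_happens'[OF sequentially_bot] by blast
      then have "infnorm (y - v) \<le> 2 * \<epsilon>"
        by (rule U.concentration_centres_close[OF That_meas])
      with \<open>\<epsilon> > 0\<close> show False
        by (simp add: \<epsilon>_def)
    qed
  qed
qed

section \<open>Equivalence of the three notions\<close>

theorem theorem4p3:
  fixes T :: "real ^ 's \<Rightarrow> real ^ 's"
    and That :: "nat \<Rightarrow> (nat \<Rightarrow> real) \<Rightarrow> real ^ 's \<Rightarrow> real ^ 's"
    and vstar v :: "real ^ 's"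
    and \<alpha> \<kappa> :: real
  assumes "0 < \<alpha>" and "\<alpha> < 1"
    and "\<And>n. n \<ge> 1 \<Longrightarrow> random_operator (That n)"
    and "\<And>v. AE \<omega> in unif_seq. (\<lambda>n. infnorm (That n \<omega> v - T v)) \<longlonglongrightarrow> 0"
    and "T vstar = vstar"
    and "infnorm vstar \<le> \<kappa>"
    and "\<And>n k v. n \<ge> 1 \<Longrightarrow> infnorm v \<le> \<kappa> \<Longrightarrow>
           AE w in unif_seqs. infnorm (iterate \<kappa> (That n) k w v) \<le> \<kappa>"
    and "\<And>v. infnorm (T v - vstar) \<le> \<alpha> * infnorm (v - vstar)"
    and "\<And>\<epsilon>. \<epsilon> > 0 \<Longrightarrow> \<exists>p :: nat \<Rightarrow> real.
           (\<forall>n\<ge>1. \<forall>v. infnorm v \<le> \<kappa> \<longrightarrow>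
              \<P>(\<omega> in unif_seq. infnorm (T v - That n \<omega> v) < \<epsilon>) > p n) \<and>
           mono_on {1..} p \<and> p \<longlonglongrightarrow> 1"
  shows "(T v = v \<longleftrightarrow> strong_prob_fixed_point That v) \<and>
         (strong_prob_fixed_point That v \<longleftrightarrow> weak_prob_fixed_point \<kappa> That v)"
proof -
  have "T v = v \<longleftrightarrow> v = vstar"
  proof
    assume "T v = v"
    then have "(1 - \<alpha>) * infnorm (v - vstar) \<le> 0"
      using assms(8)[of v] by (simp add: algebra_simps)
    with \<open>\<alpha> < 1\<close> have "infnorm (v - vstar) \<le> 0"
      by (simp add: mult_le_0_iff)
    then show "v = vstar"
      using infnorm_pos_lt[of "v - vstar"] by force
  qed (simp add: assms(5))
  moreover have "v = vstar \<longleftrightarrow> weak_prob_fixed_point \<kappa> That v"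
  proof -
    have "AE \<omega> in unif_seq. infnorm (That n \<omega> u) \<le> \<kappa>" if n: "n \<ge> 1" and u: "infnorm u \<le> \<kappa>" for n u
    proof -
      have [measurable]: "(\<lambda>\<omega>. That n \<omega> u) \<in> borel_measurable unif_seq"
        by (intro random_operator_measurable[OF assms(3)[OF n]]) simp_all
      \<comment> \<open>Invariance of the ball under the iteration, read off for a single step.\<close>
      have "AE w in unif_seqs. infnorm (That n (w 0) u) \<le> \<kappa>"
        using assms(7)[OF n u, of 1] u by (simp add: proj_step_def)
      then have "AE \<omega> in distr unif_seqs unif_seq (\<lambda>w. w 0). infnorm (That n \<omega> u) \<le> \<kappa>"
        by (subst AE_distr_iff) measurable
      then show ?thesis
        by (simp only: unif_seqs_coord_distr)
    qed
    moreover have "\<exists>p :: nat \<Rightarrow> real. p \<longlonglongrightarrow> 1 \<and> (\<forall>n\<ge>1. \<forall>v. infnorm v \<le> \<kappa> \<longrightarrow>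
        \<P>(\<omega> in unif_seq. infnorm (T v - That n \<omega> v) < \<epsilon>) \<ge> p n)" if "\<epsilon> > 0" for \<epsilon>
      using assms(9)[OF that] by (meson less_imp_le)
    ultimately have "weak_prob_fixed_point \<kappa> That vstar"
      by (intro contraction_centre_weak_prob_fixed_point[where T = T and \<alpha> = \<alpha>] assms(1-3,6,8)) auto
    then show ?thesis
      using weak_prob_fixed_point_unique[of That \<kappa> v vstar] assms(3) by blast
  qed
  ultimately show ?thesis
    using AE_limit_eq_iff_strong_prob_fixed_point[OF assms(3,4)] by blast
qed

end
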